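(* Assume $m_i^0>0$ for all $i\in\{1,\dots,n\}$. The stationary states $(\bar{\boldsymbol c}^s,\bar{\boldsymbol c}^g,\bar X)$ with $\bar X\in\{0,1\}$ are the trivial pure-phase ones $(\boldsymbol m^0,0,1)$ and $(0,\boldsymbol m^0,0)$. The remaining, non-trivial, stationary states (those with $\bar X\in(0,1)$) are characterized as follows. Case 1. If $\beta_i^*=1$ for all $i\in\{1,\dots,n\}$, then the set of non-trivial stationary states is exactly $\{(\boldsymbol m^0,\boldsymbol m^0,\bar X):\ \bar X\in(0,1)\}$. Case 2. If there exists $i_0\in\{1,\dots,n\}$ such that $\beta_{i_0}^*\neq 1$, then there exists a non-trivial stationary state if and only if $$\min\left(\sum_{i=1}^n m_i^0\beta_i^*,\ \sum_{i=1}^n \frac{m_i^0}{\beta_i^*}\right)>1 .$$ In addition, if this condition is satisfied, the non-trivial stationary state is unique.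
   Context: Let $n\ge 1$ and $\mathcal A=\{(c_1,\dots,c_n)\in\mathbb R_+^n:\ \sum_{i=1}^n c_i=1\}$. Let $\boldsymbol\mu^{*,s},\boldsymbol\mu^{*,g}\in\mathbb R^n$ be reference chemical potentials of the solid and gaseous phases and $\beta_i^*=\exp(\mu_i^{*,g}-\mu_i^{*,s})>0$. Let $\boldsymbol c^0:(0,1)\to\mathbb R^n$ be a measurable initial concentration with $\boldsymbol c^0(x)\in\mathcal A$ for almost all $x\in(0,1)$, and set $\boldsymbol m^0=(m_i^0)_{1\le i\le n}=\int_0^1\boldsymbol c^0(x)\,dx$ (so $\sum_i m_i^0=1$). Definition (stationary state). A triple $(\bar{\boldsymbol c}^s,\bar{\boldsymbol c}^g,\bar X)$, where $\bar X\in[0,1]$, $\bar{\boldsymbol c}^s\in\mathcal A$ if $\bar X>0$, and $\bar{\boldsymbol c}^g\in\mathcal A$ if $\bar X<1$, is a stationary state if and only if: (i) for all $i$, $\bar X\,\bar c_i^s+(1-\bar X)\,\bar c_i^g=m_i^0$ (mass conservation); (ii) if $\bar X=0$ (resp. $\bar X=1$), then $\bar{\boldsymbol c}^s=0$ (resp. $\bar{\boldsymbol c}^g=0$) (convention for a pure phase); (iii) if $\bar X\in(0,1)$, then for all $i$, $\sqrt{\beta_i^*}\,\bar c_i^g-\frac{1}{\sqrt{\beta_i^*}}\,\bar c_i^s=0$ (zero interface flux). *)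

theory Defs
  imports "HOL-Analysis.Analysis"
begin

text \<open>The index set $\{1,\dots,n\}$ with $n \ge 1$ is a finite type \<open>'n\<close>.\<close>

definition conc_simplex :: "(real ^ 'n) set" where
  "conc_simplex = {c. (\<forall>i. 0 \<le> c $ i) \<and> (\<Sum>i\<in>UNIV. c $ i) = 1}"

definition beta_star :: "real ^ 'n \<Rightarrow> real ^ 'n \<Rightarrow> real ^ 'n" where
  "beta_star \<mu>s \<mu>g = (\<chi> i. exp (\<mu>g $ i - \<mu>s $ i))"

definition admissible_initial :: "(real \<Rightarrow> real ^ 'n) \<Rightarrow> bool" where
  "admissible_initial c0 \<longleftrightarrow>
     c0 \<in> borel_measurable (lebesgue_on {0<..<1}) \<and>
     (AE x in lebesgue_on {0<..<1}. c0 x \<in> conc_simplex)"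

definition total_mass :: "(real \<Rightarrow> real ^ 'n) \<Rightarrow> real ^ 'n" where
  "total_mass c0 = (\<integral>x. c0 x \<partial>lebesgue_on {0<..<1})"

text \<open>The arguments \<open>cs\<close>, \<open>cg\<close> and \<open>X\<close> are the solid concentration, the gas
  concentration and the position of the interface; the solid occupies $(0,X)$.\<close>

definition stationary_state ::
  "real ^ 'n \<Rightarrow> real ^ 'n \<Rightarrow> (real ^ 'n) \<times> (real ^ 'n) \<times> real \<Rightarrow> bool" where
  "stationary_state \<beta> m0 = (\<lambda>(cs, cg, X).
     X \<in> {0..1} \<and>
     (X > 0 \<longrightarrow> cs \<in> conc_simplex) \<and>
     (X < 1 \<longrightarrow> cg \<in> conc_simplex) \<and>
     (\<forall>i. X * cs $ i + (1 - X) * cg $ i = m0 $ i) \<and>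
     (X = 0 \<longrightarrow> cs = 0) \<and>
     (X = 1 \<longrightarrow> cg = 0) \<and>
     (X \<in> {0<..<1} \<longrightarrow>
        (\<forall>i. sqrt (\<beta> $ i) * cg $ i - 1 / sqrt (\<beta> $ i) * cs $ i = 0)))"

definition pure_states ::
  "real ^ 'n \<Rightarrow> real ^ 'n \<Rightarrow> ((real ^ 'n) \<times> (real ^ 'n) \<times> real) set" where
  "pure_states \<beta> m0 = {(cs, cg, X). stationary_state \<beta> m0 (cs, cg, X) \<and> X \<in> {0, 1}}"

definition nontrivial_states ::
  "real ^ 'n \<Rightarrow> real ^ 'n \<Rightarrow> ((real ^ 'n) \<times> (real ^ 'n) \<times> real) set" where
  "nontrivial_states \<beta> m0 = {(cs, cg, X). stationary_state \<beta> m0 (cs, cg, X) \<and> X \<in> {0<..<1}}"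

end

theory Submission
  imports Defs
begin

text \<open>
  For an interface position \<open>X\<close> strictly inside the interval, the vanishing of the flux is the
  phase equilibrium \<open>c\<^sup>s\<^sub>i = \<beta>\<^sub>i c\<^sup>g\<^sub>i\<close>. Together with mass conservation this is, for each \<open>i\<close>
  separately, a linear system with the unique solution
  \<open>c\<^sup>g\<^sub>i = m\<^sub>i / (1 + X (\<beta>\<^sub>i - 1))\<close>. Hence \<open>X\<close> determines the whole state, and what
  remains is that the concentrations of each phase sum to 1. Both sums \<open>S\<^sup>s\<close>, \<open>S\<^sup>g\<close> satisfy
  \<open>X S\<^sup>s + (1 - X) S\<^sup>g = 1\<close> because the total mass is 1, so the two normalisations amount to the
  single scalar equation \<open>S\<^sup>s - S\<^sup>g = 0\<close>, that is
  \<open>\<Sum>\<^sub>i m\<^sub>i (\<beta>\<^sub>i - 1) / (1 + X (\<beta>\<^sub>i - 1)) = 0\<close> (lemma \<open>nontrivial_states_eq\<close>).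

  If every \<open>\<beta>\<^sub>i\<close> is 1, this holds for all \<open>X\<close>. Otherwise, all \<open>m\<^sub>i\<close> being positive, its left side
  \<open>phase_gap\<close> is continuous and strictly decreasing on \<open>[0,1]\<close> (lemma
  \<open>phase_gap_strict_decreasing\<close>), so it has at most one zero in \<open>(0,1)\<close>, and has one exactly
  when it is positive at 0 and negative at 1 (lemma \<open>phase_gap_root_iff\<close>). Its values there are
  \<open>\<Sum>\<^sub>i m\<^sub>i \<beta>\<^sub>i - 1\<close> and \<open>1 - \<Sum>\<^sub>i m\<^sub>i / \<beta>\<^sub>i\<close>, which gives the criterion on the minimum.
\<close>

section \<open>Total mass of the initial concentration\<close>

lemma norm_le_one_if_conc_simplex:
  fixes c :: "real ^ 'n"
  assumes "c \<in> conc_simplex"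
  shows "norm c \<le> 1"
  using norm_le_l1_cart[of c] assms by (simp add: conc_simplex_def)

text \<open>The sum of the coordinates is a bounded linear functional, so it commutes with the integral;
  on the simplex it is constantly 1, and the interval has length 1.\<close>

lemma sum_total_mass:
  fixes c0 :: "real \<Rightarrow> real ^ 'n"
  assumes "admissible_initial c0"
  shows "(\<Sum>i\<in>UNIV. total_mass c0 $ i) = 1"
proof -
  let ?M = "lebesgue_on {0<..<1::real}"
  have meas: "c0 \<in> borel_measurable ?M" and ae: "AE x in ?M. c0 x \<in> conc_simplex"
    using assms by (auto simp: admissible_initial_def)
  have fin: "finite_measure ?M"
    by (rule finite_measure_lebesgue_on) simp
  have "AE x in ?M. norm (c0 x) \<le> 1"
    using ae by eventually_elim (rule norm_le_one_if_conc_simplex)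
  then have int: "integrable ?M c0"
    by (rule finite_measure.integrable_const_bound[OF fin _ meas])
  have lin: "bounded_linear (\<lambda>c::real ^ 'n. \<Sum>i\<in>UNIV. c $ i)"
    by (intro bounded_linear_sum bounded_linear_vec_nth)
  have "(\<Sum>i\<in>UNIV. total_mass c0 $ i) = (\<integral>x. (\<Sum>i\<in>UNIV. c0 x $ i) \<partial>?M)"
    unfolding total_mass_def by (rule integral_bounded_linear[OF lin int, symmetric])
  also have "\<dots> = (\<integral>x. 1 \<partial>?M)"
  proof (rule integral_cong_AE)
    show "(\<lambda>x. \<Sum>i\<in>UNIV. c0 x $ i) \<in> borel_measurable ?M"
      using integrable_bounded_linear[OF lin int] by (rule borel_measurable_integrable)
    show "AE x in ?M. (\<Sum>i\<in>UNIV. c0 x $ i) = 1"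
      using ae by eventually_elim (simp add: conc_simplex_def)
  qed simp
  also have "\<dots> = 1"
    by (simp add: measure_restrict_space)
  finally show ?thesis .
qed

section \<open>Reduction to a scalar equation for the interface position\<close>

definition gas_conc :: "real ^ 'n \<Rightarrow> real ^ 'n \<Rightarrow> real \<Rightarrow> real ^ 'n" where
  "gas_conc \<beta> m X = (\<chi> i. m $ i / (1 + X * (\<beta> $ i - 1)))"

definition solid_conc :: "real ^ 'n \<Rightarrow> real ^ 'n \<Rightarrow> real \<Rightarrow> real ^ 'n" where
  "solid_conc \<beta> m X = (\<chi> i. \<beta> $ i * gas_conc \<beta> m X $ i)"

definition phase_gap :: "real ^ 'n \<Rightarrow> real ^ 'n \<Rightarrow> real \<Rightarrow> real" where
  "phase_gap \<beta> m X = (\<Sum>i\<in>UNIV. m $ i * ((\<beta> $ i - 1) / (1 + X * (\<beta> $ i - 1))))"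

text \<open>The quantity is the convex combination \<open>(1 - X) + X b\<close>, which gives its sign.\<close>

lemma mixture_pos:
  fixes b X :: real
  assumes "0 < b" "0 \<le> X" "X \<le> 1"
  shows "0 < 1 + X * (b - 1)"
proof -
  have "0 < (1 - X) + X * b"
  proof (cases "X = 0")
    case False
    then have "0 < X * b" using assms by simp
    then show ?thesis using assms by linarith
  qed simp
  then show ?thesis by (simp add: algebra_simps)
qed

lemma zero_flux_iff:
  fixes b g s :: real
  assumes "0 < b"
  shows "sqrt b * g - 1 / sqrt b * s = 0 \<longleftrightarrow> s = b * g"
proof -
  have "sqrt b * g - 1 / sqrt b * s = (b * g - s) / sqrt b"
    using assms by (simp add: field_simps flip: real_sqrt_mult)
  then show ?thesis using assms by auto
qed

lemma mass_and_equilibrium_iff: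
  fixes b m g s X :: real
  assumes "0 < b" "0 \<le> X" "X \<le> 1"
  shows "X * s + (1 - X) * g = m \<and> s = b * g \<longleftrightarrow>
    g = m / (1 + X * (b - 1)) \<and> s = b * g"
  using mixture_pos[OF assms] by (auto simp: field_simps)

lemma phase_gap_eq_sum_diff:
  "phase_gap \<beta> m X = (\<Sum>i\<in>UNIV. solid_conc \<beta> m X $ i) - (\<Sum>i\<in>UNIV. gas_conc \<beta> m X $ i)"
  unfolding phase_gap_def sum_subtractf[symmetric]
  by (rule sum.cong) (simp_all add: solid_conc_def gas_conc_def algebra_simps diff_divide_distrib)

text \<open>The weighted mean of the two phase sums is the total mass 1, so both are 1 as soon as they
  coincide.\<close>

lemma phases_in_simplex_iff:
  fixes \<beta> m :: "real ^ 'n"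
  assumes "\<And>i. 0 < \<beta> $ i" "\<And>i. 0 \<le> m $ i" "(\<Sum>i\<in>UNIV. m $ i) = 1" "0 \<le> X" "X \<le> 1"
  shows "solid_conc \<beta> m X \<in> conc_simplex \<and> gas_conc \<beta> m X \<in> conc_simplex \<longleftrightarrow>
    phase_gap \<beta> m X = 0"
proof -
  let ?s = "\<Sum>i\<in>UNIV. solid_conc \<beta> m X $ i"
  let ?g = "\<Sum>i\<in>UNIV. gas_conc \<beta> m X $ i"
  have pos: "0 < 1 + X * (\<beta> $ i - 1)" for i
    using mixture_pos assms by blast
  have gas_nonneg: "0 \<le> gas_conc \<beta> m X $ i" for i
    using assms(2)[of i] pos[of i] by (simp add: gas_conc_def)
  then have solid_nonneg: "0 \<le> solid_conc \<beta> m X $ i" for i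
    using assms(1)[of i] by (simp add: solid_conc_def)
  have "X * solid_conc \<beta> m X $ i + (1 - X) * gas_conc \<beta> m X $ i = m $ i" for i
    using mass_and_equilibrium_iff[OF assms(1)[of i] assms(4,5),
        where s = "solid_conc \<beta> m X $ i" and g = "gas_conc \<beta> m X $ i" and m = "m $ i"]
    unfolding solid_conc_def gas_conc_def by simp
  then have "(\<Sum>i\<in>UNIV. X * solid_conc \<beta> m X $ i + (1 - X) * gas_conc \<beta> m X $ i) = 1"
    using assms(3) by simp
  then have mean: "X * ?s + (1 - X) * ?g = 1"
    by (simp add: sum.distrib sum_distrib_left)
  have "?s = 1 \<and> ?g = 1 \<longleftrightarrow> ?s = ?g"
  proof
    assume eq: "?s = ?g"
    have "X * ?g + (1 - X) * ?g = 1" using mean unfolding eq .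
    then have "?g = 1" by (simp add: algebra_simps)
    then show "?s = 1 \<and> ?g = 1" using eq by simp
  qed simp
  then show ?thesis
    using gas_nonneg solid_nonneg by (simp add: conc_simplex_def phase_gap_eq_sum_diff)
qed

lemma nontrivial_states_eq:
  fixes \<beta> m :: "real ^ 'n"
  assumes "\<And>i. 0 < \<beta> $ i" "\<And>i. 0 \<le> m $ i" "(\<Sum>i\<in>UNIV. m $ i) = 1"
  shows "nontrivial_states \<beta> m =
    {(solid_conc \<beta> m X, gas_conc \<beta> m X, X) | X. X \<in> {0<..<1} \<and> phase_gap \<beta> m X = 0}"
proof -
  have "stationary_state \<beta> m (cs, cg, X) \<longleftrightarrow>
      cs = solid_conc \<beta> m X \<and> cg = gas_conc \<beta> m X \<and> phase_gap \<beta> m X = 0"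
    if X: "0 < X" "X < 1" for cs cg X
  proof -
    have "(\<forall>i. X * cs $ i + (1 - X) * cg $ i = m $ i) \<and>
        (\<forall>i. sqrt (\<beta> $ i) * cg $ i - 1 / sqrt (\<beta> $ i) * cs $ i = 0) \<longleftrightarrow>
      (\<forall>i. X * cs $ i + (1 - X) * cg $ i = m $ i \<and> cs $ i = \<beta> $ i * cg $ i)"
      by (simp only: zero_flux_iff[OF assms(1)]) blast
    also have "\<dots> \<longleftrightarrow>
      (\<forall>i. cg $ i = m $ i / (1 + X * (\<beta> $ i - 1)) \<and> cs $ i = \<beta> $ i * cg $ i)"
      using mass_and_equilibrium_iff[OF assms(1)] X by simp
    also have "\<dots> \<longleftrightarrow> cs = solid_conc \<beta> m X \<and> cg = gas_conc \<beta> m X"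
      by (auto simp: vec_eq_iff solid_conc_def gas_conc_def)
    finally have "stationary_state \<beta> m (cs, cg, X) \<longleftrightarrow>
        (cs \<in> conc_simplex \<and> cg \<in> conc_simplex) \<and>
        cs = solid_conc \<beta> m X \<and> cg = gas_conc \<beta> m X"
      using X by (auto simp: stationary_state_def)
    then show ?thesis
      using phases_in_simplex_iff[OF assms, of X] X by auto
  qed
  then show ?thesis
    unfolding nontrivial_states_def by auto
qed

section \<open>Zeros of the phase gap\<close>

lemma continuous_on_phase_gap:
  fixes \<beta> m :: "real ^ 'n"
  assumes "\<And>i. 0 < \<beta> $ i"
  shows "continuous_on {0..1} (phase_gap \<beta> m)"
proof -
  have "1 + X * (\<beta> $ i - 1) \<noteq> 0" if "X \<in> {0..1}" for X i
    using mixture_pos[OF assms, of X i] that by simp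
  then show ?thesis
    unfolding phase_gap_def by (intro continuous_intros) auto
qed

lemma phase_gap_0:
  assumes "(\<Sum>i\<in>UNIV. m $ i) = 1"
  shows "phase_gap \<beta> m 0 = (\<Sum>i\<in>UNIV. m $ i * \<beta> $ i) - 1"
  using assms by (simp add: phase_gap_def algebra_simps sum_subtractf)

lemma phase_gap_1:
  fixes \<beta> m :: "real ^ 'n"
  assumes "\<And>i. 0 < \<beta> $ i" "(\<Sum>i\<in>UNIV. m $ i) = 1"
  shows "phase_gap \<beta> m 1 = 1 - (\<Sum>i\<in>UNIV. m $ i / \<beta> $ i)"
proof -
  have "\<beta> $ i \<noteq> 0" for i
    using assms(1)[of i] by simp
  then have "phase_gap \<beta> m 1 = (\<Sum>i\<in>UNIV. m $ i - m $ i / \<beta> $ i)"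
    unfolding phase_gap_def by (intro sum.cong) (simp_all add: field_simps)
  then show ?thesis
    using assms(2) by (simp add: sum_subtractf)
qed

text \<open>Over a common denominator, the difference of the values at \<open>x\<close> and \<open>y\<close> has the numerator
  \<open>(b - 1)\<^sup>2 (y - x)\<close>: the value decreases in the
  position for \<open>b < 1\<close> as well as for \<open>b > 1\<close>.\<close>

lemma gap_summand_diff:
  fixes b x y :: real
  assumes "0 < b" "0 \<le> x" "x \<le> 1" "0 \<le> y" "y \<le> 1"
  shows "(b - 1) / (1 + x * (b - 1)) - (b - 1) / (1 + y * (b - 1)) =
    (b - 1)\<^sup>2 * (y - x) / ((1 + x * (b - 1)) * (1 + y * (b - 1)))"
proof -
  have "1 + x * (b - 1) \<noteq> 0" "1 + y * (b - 1) \<noteq> 0"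
    using mixture_pos assms by (metis less_irrefl)+
  then show ?thesis
    by (simp add: diff_frac_eq) (simp add: algebra_simps power2_eq_square)
qed

lemma phase_gap_strict_decreasing:
  fixes \<beta> m :: "real ^ 'n"
  assumes "\<And>i. 0 < \<beta> $ i" "\<And>i. 0 < m $ i" "\<beta> $ i0 \<noteq> 1"
    and "0 \<le> x" "x < y" "y \<le> 1"
  shows "phase_gap \<beta> m y < phase_gap \<beta> m x"
  unfolding phase_gap_def
proof (rule sum_strict_mono_ex1)
  have pos: "0 < 1 + x * (\<beta> $ i - 1)" "0 < 1 + y * (\<beta> $ i - 1)" for i
    using mixture_pos[OF assms(1)] assms(4-6) by simp_all
  have diff: "(\<beta> $ i - 1) / (1 + x * (\<beta> $ i - 1)) - (\<beta> $ i - 1) / (1 + y * (\<beta> $ i - 1)) =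
      (\<beta> $ i - 1)\<^sup>2 * (y - x) / ((1 + x * (\<beta> $ i - 1)) * (1 + y * (\<beta> $ i - 1)))" for i
    using gap_summand_diff[OF assms(1)] assms(4-6) by simp
  have "0 \<le> (\<beta> $ i - 1) / (1 + x * (\<beta> $ i - 1)) - (\<beta> $ i - 1) / (1 + y * (\<beta> $ i - 1))" for i
    unfolding diff using pos[of i] assms(5)
    by (intro divide_nonneg_pos mult_nonneg_nonneg mult_pos_pos) simp_all
  then show "\<forall>i\<in>UNIV. m $ i * ((\<beta> $ i - 1) / (1 + y * (\<beta> $ i - 1))) \<le>
      m $ i * ((\<beta> $ i - 1) / (1 + x * (\<beta> $ i - 1)))"
    using assms(2) by (intro ballI mult_left_mono) (simp_all add: less_imp_le)
  have "0 < (\<beta> $ i0 - 1) / (1 + x * (\<beta> $ i0 - 1)) - (\<beta> $ i0 - 1) / (1 + y * (\<beta> $ i0 - 1))"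
    unfolding diff using pos[of i0] assms(3,5)
    by (intro divide_pos_pos mult_pos_pos) simp_all
  then show "\<exists>i\<in>UNIV. m $ i * ((\<beta> $ i - 1) / (1 + y * (\<beta> $ i - 1))) <
      m $ i * ((\<beta> $ i - 1) / (1 + x * (\<beta> $ i - 1)))"
    using assms(2) by (intro bexI[of _ i0] mult_strict_left_mono) simp_all
qed simp

lemma phase_gap_root_iff:
  fixes \<beta> m :: "real ^ 'n"
  assumes "\<And>i. 0 < \<beta> $ i" "\<And>i. 0 < m $ i" "(\<Sum>i\<in>UNIV. m $ i) = 1" "\<beta> $ i0 \<noteq> 1"
  shows "(\<exists>X\<in>{0<..<1}. phase_gap \<beta> m X = 0) \<longleftrightarrow>
    1 < min (\<Sum>i\<in>UNIV. m $ i * \<beta> $ i) (\<Sum>i\<in>UNIV. m $ i / \<beta> $ i)"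
proof -
  note decr = phase_gap_strict_decreasing[OF assms(1,2,4)]
  have "(\<exists>X\<in>{0<..<1}. phase_gap \<beta> m X = 0) \<longleftrightarrow> 0 < phase_gap \<beta> m 0 \<and> phase_gap \<beta> m 1 < 0"
  proof
    assume "\<exists>X\<in>{0<..<1}. phase_gap \<beta> m X = 0"
    then obtain X where "0 < X" "X < 1" "phase_gap \<beta> m X = 0" by auto
    then show "0 < phase_gap \<beta> m 0 \<and> phase_gap \<beta> m 1 < 0"
      using decr[of 0 X] decr[of X 1] by simp
  next
    assume ends: "0 < phase_gap \<beta> m 0 \<and> phase_gap \<beta> m 1 < 0"
    obtain X where X: "0 \<le> X" "X \<le> 1" "phase_gap \<beta> m X = 0"
      using IVT2'[of "phase_gap \<beta> m" 1 0 0] ends continuous_on_phase_gap[OF assms(1)] by auto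
    with ends have "X \<noteq> 0" "X \<noteq> 1" by auto
    with X show "\<exists>X\<in>{0<..<1}. phase_gap \<beta> m X = 0" by force
  qed
  then show ?thesis
    by (simp add: phase_gap_0[OF assms(3)] phase_gap_1[OF assms(1,3)])
qed

lemma phase_gap_root_unique:
  fixes \<beta> m :: "real ^ 'n"
  assumes "\<And>i. 0 < \<beta> $ i" "\<And>i. 0 < m $ i" "\<beta> $ i0 \<noteq> 1"
    and "X \<in> {0<..<1}" "Y \<in> {0<..<1}" "phase_gap \<beta> m X = 0" "phase_gap \<beta> m Y = 0"
  shows "X = Y"
  using phase_gap_strict_decreasing[OF assms(1-3), of X Y]
    phase_gap_strict_decreasing[OF assms(1-3), of Y X] assms(4-7)
  by (cases X Y rule: linorder_cases) auto

section \<open>Classification of the stationary states\<close>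

lemma pure_states_eq:
  assumes "m \<in> conc_simplex"
  shows "pure_states \<beta> m = {(m, 0, 1), (0, m, 0)}"
  using assms by (auto simp: pure_states_def stationary_state_def vec_eq_iff)

theorem proposition1:
  fixes \<mu>s \<mu>g \<beta> m0 :: "real ^ 'n" and c0 :: "real \<Rightarrow> real ^ 'n"
  assumes "\<beta> = beta_star \<mu>s \<mu>g"
    and "admissible_initial c0"
    and "m0 = total_mass c0"
    and "\<forall>i. m0 $ i > 0"
  shows "pure_states \<beta> m0 = {(m0, 0, 1), (0, m0, 0)} \<and>
    ((\<forall>i. \<beta> $ i = 1) \<longrightarrow>
      nontrivial_states \<beta> m0 = {(m0, m0, X) | X. X \<in> {0<..<1}}) \<and>
    ((\<exists>i0. \<beta> $ i0 \<noteq> 1) \<longrightarrow>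
      ((\<exists>S. S \<in> nontrivial_states \<beta> m0) \<longleftrightarrow>
        min (\<Sum>i\<in>UNIV. m0 $ i * \<beta> $ i) (\<Sum>i\<in>UNIV. m0 $ i / \<beta> $ i) > 1) \<and>
      (min (\<Sum>i\<in>UNIV. m0 $ i * \<beta> $ i) (\<Sum>i\<in>UNIV. m0 $ i / \<beta> $ i) > 1 \<longrightarrow>
        (\<exists>!S. S \<in> nontrivial_states \<beta> m0)))"
proof -
  have \<beta>_pos: "0 < \<beta> $ i" for i
    using assms(1) by (simp add: beta_star_def)
  have m_pos: "0 < m0 $ i" for i
    using assms(4) by blast
  have m_nonneg: "0 \<le> m0 $ i" for i
    using m_pos[of i] by simp
  have m_sum: "(\<Sum>i\<in>UNIV. m0 $ i) = 1"
    using sum_total_mass[OF assms(2)] assms(3) by simp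
  note states = nontrivial_states_eq[OF \<beta>_pos m_nonneg m_sum]
  have pure: "pure_states \<beta> m0 = {(m0, 0, 1), (0, m0, 0)}"
    using m_nonneg m_sum by (intro pure_states_eq) (simp add: conc_simplex_def)
  have equal: "nontrivial_states \<beta> m0 = {(m0, m0, X) | X. X \<in> {0<..<1}}"
    if "\<forall>i. \<beta> $ i = 1"
  proof -
    have "gas_conc \<beta> m0 X = m0" "solid_conc \<beta> m0 X = m0" "phase_gap \<beta> m0 X = 0" for X
      using that by (simp_all add: vec_eq_iff gas_conc_def solid_conc_def phase_gap_def)
    then show ?thesis
      unfolding states by simp
  qed
  have exists_iff: "(\<exists>S. S \<in> nontrivial_states \<beta> m0) \<longleftrightarrow>
      min (\<Sum>i\<in>UNIV. m0 $ i * \<beta> $ i) (\<Sum>i\<in>UNIV. m0 $ i / \<beta> $ i) > 1"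
    if "\<beta> $ i0 \<noteq> 1" for i0
    using phase_gap_root_iff[OF \<beta>_pos m_pos m_sum that] unfolding states by blast
  have unique: "S = T"
    if "\<beta> $ i0 \<noteq> 1" "S \<in> nontrivial_states \<beta> m0" "T \<in> nontrivial_states \<beta> m0" for i0 S T
    using that(2,3) phase_gap_root_unique[OF \<beta>_pos m_pos that(1)] unfolding states by blast
  show ?thesis
    using pure equal exists_iff unique by blast
qed

end
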